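(* Let $Q\colon\mathbb R^{3\times 3}\to\mathbb R$ be the quadratic form $$Q(\xi)=(\xi_{11}^2+\xi_{22}^2+\xi_{33}^2-2\xi_{11}\xi_{22}-2\xi_{22}\xi_{33}-2\xi_{33}\xi_{11})+\xi_{12}^2+\xi_{23}^2+\xi_{31}^2 .$$ Then: (i) $Q$ is quasiconvex; (ii) $Q$ is not polyconvex; (iii) $Q$ is an extremal in all three senses, i.e. it is extremal in sense 1, in sense 2, and in sense 3 (both sense 1 and sense 2).
   Context: For $x,y\in\mathbb R^3$, $x\otimes y$ denotes the matrix with entries $(x\otimes y)_{ij}=x_iy_j$. A quadratic form $f$ on $\mathbb R^{3\times3}$ is quasiconvex if and only if $f(x\otimes y)\ge 0$ for all $x,y\in\mathbb R^3$ (for quadratic forms this is equivalent to Morrey's quasiconvexity and to rank-one convexity). A null-Lagrangian quadratic form is a linear combination of the nine $2\times 2$ minors of $\xi$ (equivalently, a quadratic form vanishing on all matrices $x\otimes y$). A quadratic form is polyconvex if and only if it is the sum of a convex quadratic form and a null-Lagrangian quadratic form. A rank-one quadratic form is a form $\xi\mapsto\big(\sum_{i,j}b_{ij}\xi_{ij}\big)^2$ with $(b_{ij})\neq 0$. Extremality of a quasiconvex quadratic form $f$: Sense 1: one cannot subtract a rank-one quadratic form from $f$ while preserving quasiconvexity, i.e. there is no rank-one quadratic form $g$ such that $f-g$ is quasiconvex. Sense 2: one cannot subtract from $f$ a quasiconvex quadratic form, other than a multiple of $f$ modulo null-Lagrangians, while preserving quasiconvexity; i.e. whenever $g$ and $f-g$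 are both quasiconvex quadratic forms, there is $\lambda\in\mathbb R$ such that $g-\lambda f$ is a null-Lagrangian. Sense 3: $f$ is extremal in both sense 1 and sense 2. *)

theory Defs
  imports "HOL-Analysis.Analysis"
begin

definition tensor :: "real^3 \<Rightarrow> real^3 \<Rightarrow> real^3^3"  (infixl \<open>\<otimes>\<^sub>t\<close> 75)
  where "x \<otimes>\<^sub>t y = (\<chi> i j. x $ i * y $ j)"

definition quadratic_form :: "(real^3^3 \<Rightarrow> real) \<Rightarrow> bool"
  where "quadratic_form f \<longleftrightarrow> (\<exists>B. bilinear B \<and> (\<forall>\<xi>. f \<xi> = B \<xi> \<xi>))"

text \<open>For quadratic forms, nonnegativity on the matrices of rank at most one is equivalent to
  Morrey's quasiconvexity; it is taken as the definition.\<close>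

definition quasiconvex_form :: "(real^3^3 \<Rightarrow> real) \<Rightarrow> bool"
  where "quasiconvex_form f \<longleftrightarrow> quadratic_form f \<and> (\<forall>x y. f (x \<otimes>\<^sub>t y) \<ge> 0)"

text \<open>Arithmetic in the index type \<open>3\<close> is modulo 3, so \<open>i + 1, i + 2\<close> are the two rows other
  than \<open>i\<close>, and \<open>j + 1, j + 2\<close> the two columns other than \<open>j\<close>, in cyclic order. Up to sign,
  \<open>minor2 i j \<xi>\<close> is thus the minor of \<open>\<xi>\<close> obtained by deleting row \<open>i\<close> and column \<open>j\<close>.\<close>

definition minor2 :: "3 \<Rightarrow> 3 \<Rightarrow> real^3^3 \<Rightarrow> real"
  where "minor2 i j \<xi> =
    \<xi> $ (i + 1) $ (j + 1) * \<xi> $ (i + 2) $ (j + 2) - \<xi> $ (i + 1) $ (j + 2) * \<xi> $ (i + 2) $ (j + 1)"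

definition null_lagrangian :: "(real^3^3 \<Rightarrow> real) \<Rightarrow> bool"
  where "null_lagrangian f \<longleftrightarrow>
    (\<exists>c :: real^3^3. \<forall>\<xi>. f \<xi> = (\<Sum>i\<in>UNIV. \<Sum>j\<in>UNIV. c $ i $ j * minor2 i j \<xi>))"

definition polyconvex_form :: "(real^3^3 \<Rightarrow> real) \<Rightarrow> bool"
  where "polyconvex_form f \<longleftrightarrow>
    (\<exists>g h. quadratic_form g \<and> convex_on UNIV g \<and> null_lagrangian h \<and> (\<forall>\<xi>. f \<xi> = g \<xi> + h \<xi>))"

definition rank_one_form :: "(real^3^3 \<Rightarrow> real) \<Rightarrow> bool"
  where "rank_one_form g \<longleftrightarrow>
    (\<exists>b :: real^3^3. b \<noteq> 0 \<and> (\<forall>\<xi>. g \<xi> = (\<Sum>i\<in>UNIV. \<Sum>j\<in>UNIV. b $ i $ j * \<xi> $ i $ j)\<^sup>2))"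

definition extremal_sense1 :: "(real^3^3 \<Rightarrow> real) \<Rightarrow> bool"
  where "extremal_sense1 f \<longleftrightarrow> quasiconvex_form f \<and>
    \<not> (\<exists>g. rank_one_form g \<and> quasiconvex_form (\<lambda>\<xi>. f \<xi> - g \<xi>))"

definition extremal_sense2 :: "(real^3^3 \<Rightarrow> real) \<Rightarrow> bool"
  where "extremal_sense2 f \<longleftrightarrow> quasiconvex_form f \<and>
    (\<forall>g. quasiconvex_form g \<and> quasiconvex_form (\<lambda>\<xi>. f \<xi> - g \<xi>) \<longrightarrow>
      (\<exists>c :: real. null_lagrangian (\<lambda>\<xi>. g \<xi> - c * f \<xi>)))"

definition extremal_sense3 :: "(real^3^3 \<Rightarrow> real) \<Rightarrow> bool"
  where "extremal_sense3 f \<longleftrightarrow> extremal_sense1 f \<and> extremal_sense2 f"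

definition Q :: "real^3^3 \<Rightarrow> real"
  where "Q \<xi> =
    ((\<xi> $ 1 $ 1)\<^sup>2 + (\<xi> $ 2 $ 2)\<^sup>2 + (\<xi> $ 3 $ 3)\<^sup>2
      - 2 * \<xi> $ 1 $ 1 * \<xi> $ 2 $ 2 - 2 * \<xi> $ 2 $ 2 * \<xi> $ 3 $ 3 - 2 * \<xi> $ 3 $ 3 * \<xi> $ 1 $ 1)
    + (\<xi> $ 1 $ 2)\<^sup>2 + (\<xi> $ 2 $ 3)\<^sup>2 + (\<xi> $ 3 $ 1)\<^sup>2"

end

theory Submission
  imports Defs
begin

text \<open>Let \<open>g\<close> be a quasiconvex form with symmetric bilinear form \<open>B\<close> such that \<open>Q - g\<close> is
  quasiconvex. For fixed \<open>x\<close>, the form \<open>y \<mapsto> g (x \<otimes> y)\<close> is positive semidefinite and dominated by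
  \<open>Q (x \<otimes> y)\<close>, so by Cauchy--Schwarz \<open>B (x \<otimes> y, x \<otimes> z)\<^sup>2 \<le> Q (x \<otimes> y) Q (x \<otimes> z)\<close>, and similarly with
  the roles of \<open>x\<close> and \<open>y\<close> exchanged. This is exploited at the zeros of \<open>Q\<close> on the rank-one cone:
  the matrices \<open>s \<otimes> s\<close> with \<open>s\<close> a sign vector, and the degenerate zeros \<open>e\<^sub>i \<otimes> e\<^sub>i\<^sub>+\<^sub>2\<close>, near which \<open>Q\<close>
  vanishes to fourth order along \<open>(e\<^sub>i + t e\<^sub>i\<^sub>+\<^sub>2) \<otimes> (t e\<^sub>i + e\<^sub>i\<^sub>+\<^sub>2)\<close>. The resulting linear equations
  force \<open>g\<close> to be a multiple of \<open>Q\<close> on rank-one matrices, which is extremality in sense 2. For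
  \<open>g = (\<Sum> b\<^sub>i\<^sub>j \<xi>\<^sub>i\<^sub>j)\<^sup>2\<close> with multiple \<open>a\<close> they give \<open>b\<^sub>1\<^sub>1 b\<^sub>2\<^sub>2 = b\<^sub>2\<^sub>2 b\<^sub>3\<^sub>3 = b\<^sub>3\<^sub>3 b\<^sub>1\<^sub>1 = - a\<close>, whose product is a
  square, so \<open>a = 0\<close> and \<open>b = 0\<close>. Finally, if \<open>Q = g + h\<close> with \<open>g\<close> convex and \<open>h\<close> null-Lagrangian, the
  zeros of \<open>Q\<close> lie in the kernel of \<open>g\<close>, hence so does \<open>e\<^sub>1 \<otimes> e\<^sub>2\<close>, contradicting \<open>Q (e\<^sub>1 \<otimes> e\<^sub>2) = 1\<close>.\<close>

section \<open>Index arithmetic modulo 3 and nonnegativity of the Choi-Lam biquadratic form\<close>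

lemma numeral_mod_3 [simp]: "(4::3) = 1" "(5::3) = 2"
  by simp_all

text \<open>Measuring the other two variables from the least one turns the difference of the two
  sides into a sum of nonnegative terms.\<close>

lemma cyclic_amgm_least:
  fixes a b c :: real
  assumes "0 \<le> c" "c \<le> a" "c \<le> b"
  shows "3 * a * b * c \<le> a\<^sup>2 * b + b\<^sup>2 * c + c\<^sup>2 * a"
proof -
  define p q where "p = b - c" and "q = a - c"
  have "p\<^sup>2 - p * q + q\<^sup>2 = (p - q / 2)\<^sup>2 + 3 * (q / 2)\<^sup>2"
    by (simp add: power2_eq_square field_simps)
  then have "0 \<le> p\<^sup>2 - p * q + q\<^sup>2"
    by simp
  then have "0 \<le> c * (p\<^sup>2 - p * q + q\<^sup>2) + q\<^sup>2 * p"
    using assms by (simp add: p_def)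
  also have "\<dots> = a\<^sup>2 * b + b\<^sup>2 * c + c\<^sup>2 * a - 3 * a * b * c"
    by (simp add: p_def q_def power2_eq_square algebra_simps)
  finally show ?thesis by simp
qed

lemma cyclic_amgm:
  fixes a b c :: real
  assumes "0 \<le> a" "0 \<le> b" "0 \<le> c"
  shows "3 * a * b * c \<le> a\<^sup>2 * b + b\<^sup>2 * c + c\<^sup>2 * a"
proof -
  consider "c \<le> a" "c \<le> b" | "a \<le> b" "a \<le> c" | "b \<le> c" "b \<le> a"
    by linarith
  then show ?thesis
    using cyclic_amgm_least[of c a b] cyclic_amgm_least[of a b c] cyclic_amgm_least[of b c a] assms
    by cases (simp_all add: mult_ac add_ac)
qed

lemma choi_lam_nonneg:
  fixes x1 x2 x3 y1 y2 y3 :: real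
  shows "0 \<le> (x1*y1)\<^sup>2 + (x2*y2)\<^sup>2 + (x3*y3)\<^sup>2 - 2*(x1*y1)*(x2*y2) - 2*(x2*y2)*(x3*y3) - 2*(x3*y3)*(x1*y1)
    + (x1*y2)\<^sup>2 + (x2*y3)\<^sup>2 + (x3*y1)\<^sup>2" (is "0 \<le> ?F")
\<comment> \<open>The case \<open>x1 = 0\<close> is split off because \<open>D\<close> below
  vanishes when \<open>x1\<close> and \<open>x2\<close> both do, and the main argument needs
  \<open>0 < D\<close>.\<close>
proof (cases "x1 = 0")
  case True
  then have "?F = (x2*y2 - x3*y3)\<^sup>2 + (x2*y3)\<^sup>2 + (x3*y1)\<^sup>2"
    by (simp add: power2_eq_square algebra_simps)
  then show ?thesis by simp
next
  case False
  \<comment> \<open>\<open>A\<close>, \<open>D\<close>, \<open>d\<close> are the leading principal minors of \<open>?F\<close> as a quadratic form in \<open>y\<close>;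
    \<open>L\<close> and \<open>M\<close> come from completing squares.\<close>
  define A where "A = x1\<^sup>2 + x3\<^sup>2"
  define D where "D = (x1\<^sup>2)\<^sup>2 + x2\<^sup>2 * x3\<^sup>2 + x1\<^sup>2 * x3\<^sup>2"
  define d where "d = (x1\<^sup>2)\<^sup>2 * x2\<^sup>2 + (x2\<^sup>2)\<^sup>2 * x3\<^sup>2 + (x3\<^sup>2)\<^sup>2 * x1\<^sup>2 - 3 * x1\<^sup>2 * x2\<^sup>2 * x3\<^sup>2"
  define L where "L = A * y1 - x1*x2*y2 - x1*x3*y3"
  define M where "M = D * y2 - (A*x2*x3 + x1\<^sup>2*x2*x3) * y3"
  have "0 < A" "0 < D"
    using False by (simp_all add: A_def D_def add_pos_nonneg)
  moreover have "0 \<le> d"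
    using cyclic_amgm[of "x1\<^sup>2" "x2\<^sup>2" "x3\<^sup>2"] by (simp add: d_def)
  moreover have "A * D * ?F = D * L\<^sup>2 + M\<^sup>2 + A * d * y3\<^sup>2"
    unfolding L_def M_def d_def A_def D_def by algebra
  ultimately have "0 \<le> A * D * ?F" by simp
  with \<open>0 < A\<close> \<open>0 < D\<close> show ?thesis
    by (meson mult_pos_pos not_le zero_le_mult_iff)
qed

section \<open>Quadratic forms and symmetric bilinear forms\<close>

lemma quadratic_formE:
  assumes "quadratic_form f"
  obtains B where "bilinear B" "\<And>x y. B x y = B y x" "\<And>\<xi>. f \<xi> = B \<xi> \<xi>"
proof -
  from assms obtain B where B: "bilinear B" "\<And>\<xi>. f \<xi> = B \<xi> \<xi>"
    unfolding quadratic_form_def by blast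
  show thesis
  proof
    show "bilinear (\<lambda>x y. (B x y + B y x) / 2)"
      unfolding bilinear_def linear_iff
      by (simp add: bilinear_ladd[OF B(1)] bilinear_radd[OF B(1)] bilinear_lmul[OF B(1)]
          bilinear_rmul[OF B(1)] algebra_simps add_divide_distrib)
  qed (simp_all add: B(2))
qed

text \<open>Nonnegativity is asked only at \<open>v\<close> and along one line, so that the
  inequality applies to forms that are nonnegative merely on rank-one matrices.\<close>

lemma bilinear_Cauchy_Schwarz:
  fixes B :: "'a::real_vector \<Rightarrow> 'a \<Rightarrow> real"
  assumes B: "bilinear B" "\<And>x y. B x y = B y x"
    and nonneg: "\<And>s. 0 \<le> B (u + s *\<^sub>R v) (u + s *\<^sub>R v)" "0 \<le> B v v"
  shows "(B u v)\<^sup>2 \<le> B u u * B v v"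
proof -
  have *: "B (u + s *\<^sub>R v) (u + s *\<^sub>R v) = B u u + 2 * s * B u v + s\<^sup>2 * B v v" for s
    by (simp add: bilinear_ladd[OF B(1)] bilinear_radd[OF B(1)] bilinear_lmul[OF B(1)]
        bilinear_rmul[OF B(1)] B(2)[of v u] power2_eq_square algebra_simps)
  show ?thesis
  proof (cases "B v v = 0")
    case True
    have "B u v = 0"
    proof (rule ccontr)
      assume "B u v \<noteq> 0"
      \<comment> \<open>With \<open>B v v = 0\<close> the expression is affine in \<open>s\<close>;
        the chosen \<open>s\<close> gives it the value \<open>-1\<close>.\<close>
      then show False
        using nonneg(1)[of "- (B u u + 1) / (2 * B u v)"] True unfolding * by (simp add: field_simps)
    qed
    with True show ?thesis by simp
  next
    case False
    with nonneg(2) have "0 < B v v" by simp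
    then show ?thesis
      using nonneg(1)[of "- B u v / B v v"] unfolding *
      by (simp add: field_simps power2_eq_square)
  qed
qed

section \<open>Tensor products, matrix units and null-Lagrangians\<close>

abbreviation e :: "3 \<Rightarrow> real^3" where "e i \<equiv> axis i 1"
abbreviation E :: "3 \<Rightarrow> 3 \<Rightarrow> real^3^3" where "E i j \<equiv> e i \<otimes>\<^sub>t e j"

lemma tensor_nth [simp]: "(x \<otimes>\<^sub>t y) $ i $ j = x $ i * y $ j"
  by (simp add: tensor_def)

lemma tensor_add_left: "(x + x') \<otimes>\<^sub>t y = x \<otimes>\<^sub>t y + x' \<otimes>\<^sub>t y"
  and tensor_add_right: "x \<otimes>\<^sub>t (y + y') = x \<otimes>\<^sub>t y + x \<otimes>\<^sub>t y'"
  and tensor_scaleR_left: "(c *\<^sub>R x) \<otimes>\<^sub>t y = c *\<^sub>R (x \<otimes>\<^sub>t y)"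
  and tensor_scaleR_right: "x \<otimes>\<^sub>t (c *\<^sub>R y) = c *\<^sub>R (x \<otimes>\<^sub>t y)"
  by (simp_all add: vec_eq_iff algebra_simps)

lemma matrix_expand: "\<xi> = (\<Sum>i\<in>UNIV. \<Sum>j\<in>UNIV. \<xi> $ i $ j *\<^sub>R E i j)"
  by (simp add: vec_eq_iff forall_3 sum_3 axis_def)

lemma bilinear_expand:
  assumes "bilinear B"
  shows "B \<xi> \<eta> = (\<Sum>i\<in>UNIV. \<Sum>j\<in>UNIV. \<Sum>k\<in>UNIV. \<Sum>l\<in>UNIV.
    \<xi> $ i $ j * \<eta> $ k $ l * (B (E i j) (E k l) :: real))"
proof -
  have l: "linear (\<lambda>x. B x y)" and r: "linear (B x)" for x y
    using assms by (simp_all add: bilinear_def)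
  have left: "B \<xi> y = (\<Sum>i\<in>UNIV. \<Sum>j\<in>UNIV. \<xi> $ i $ j * B (E i j) y)" for y
    by (subst matrix_expand) (simp add: linear_sum[OF l] linear_cmul[OF l])
  have right: "B x \<eta> = (\<Sum>k\<in>UNIV. \<Sum>m\<in>UNIV. \<eta> $ k $ m * B x (E k m))" for x
    by (subst matrix_expand) (simp add: linear_sum[OF r] linear_cmul[OF r])
  show ?thesis
    by (subst left, subst right) (simp add: sum_distrib_left mult.assoc)
qed

text \<open>The hypothesis \<open>swap\<close> is the polarised form of vanishing on all
  \<open>x \<otimes>\<^sub>t y\<close>. It gives opposite coefficients to two products that differ
  by exchanging columns, so they combine into minors.\<close>

lemma null_lagrangianI:
  assumes D: "bilinear D" "\<And>x y. D x y = D y x"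
    and swap: "\<And>i j k l. D (E i j) (E k l) + D (E i l) (E k j) = 0"
  shows "null_lagrangian (\<lambda>\<xi>. D \<xi> \<xi>)"
  unfolding null_lagrangian_def
proof (intro exI allI)
  define b where "b i j k l = D (E i j) (E k l)" for i j k l
  have sw: "b i j k l = - b i l k j" and sy: "b i j k l = b k l i j" for i j k l
    using swap[of i j k l] D(2) by (simp_all add: b_def)
  have z1: "b i j i l = 0" for i j l using sw[of i j i l] sy[of i j i l] by simp
  have z2: "b i j k j = 0" for i j k using sw[of i j k j] by simp
  fix \<xi> :: "real^3^3"
  \<comment> \<open>The factor \<open>2\<close> appears because, by symmetry, each product of two
    distinct entries occurs twice in the expansion.\<close>
  let ?c = "(\<chi> i j. 2 * D (E (i+1) (j+1)) (E (i+2) (j+2))) :: real^3^3"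
  show "D \<xi> \<xi> = (\<Sum>i\<in>UNIV. \<Sum>j\<in>UNIV. ?c $ i $ j * minor2 i j \<xi>)"
    unfolding bilinear_expand[OF D(1), of \<xi> \<xi>] b_def[symmetric] minor2_def vec_lambda_beta
    using sw[of 1 1 2 2] sw[of 1 2 2 3] sw[of 1 1 2 3] sw[of 1 1 3 2] sw[of 1 2 3 3] sw[of 1 1 3 3] sw[of 2 1 3 2] sw[of 2 2 3 3] sw[of 2 1 3 3]
    by (simp add: sum_3 z1 z2 sy[of 2 _ 1] sy[of 3 _ 1] sy[of 3 _ 2] algebra_simps)
qed

text \<open>The bound makes the polynomial \<open>O(t\<^sup>2)\<close> at \<open>0\<close>, which
  excludes terms of order 0 and 1.\<close>

lemma linear_coeff_zero:
  fixes c0 c1 c2 c3 :: real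
  assumes "\<And>t. (c0 + c1 * t + c2 * t\<^sup>2 + c3 * t ^ 3)\<^sup>2 \<le> t ^ 4 * (1 + t\<^sup>2)"
  shows "c0 = 0" "c1 = 0"
proof -
  show c0: "c0 = 0" using assms[of 0] by simp
  have "((\<lambda>t. (c1 + c2 * t + c3 * t\<^sup>2)\<^sup>2) \<longlongrightarrow> (c1 + c2 * 0 + c3 * 0\<^sup>2)\<^sup>2) (at 0)"
    by (intro tendsto_intros)
  moreover have "((\<lambda>t::real. t\<^sup>2 * (1 + t\<^sup>2)) \<longlongrightarrow> 0\<^sup>2 * (1 + 0\<^sup>2)) (at 0)"
    by (intro tendsto_intros)
  moreover have "eventually (\<lambda>t. (c1 + c2 * t + c3 * t\<^sup>2)\<^sup>2 \<le> t\<^sup>2 * (1 + t\<^sup>2)) (at 0)"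
    unfolding eventually_at_filter
  proof (intro always_eventually allI impI)
    fix t :: real assume "t \<noteq> 0"
    have "t\<^sup>2 * (c1 + c2 * t + c3 * t\<^sup>2)\<^sup>2 \<le> t\<^sup>2 * (t\<^sup>2 * (1 + t\<^sup>2))"
      using assms[of t] by (simp add: c0 power2_eq_square eval_nat_numeral algebra_simps)
    with \<open>t \<noteq> 0\<close> show "(c1 + c2 * t + c3 * t\<^sup>2)\<^sup>2 \<le> t\<^sup>2 * (1 + t\<^sup>2)"
      by (rule_tac mult_left_le_imp_le[of "t\<^sup>2"]) simp_all
  qed
  ultimately have "(c1 + c2 * 0 + c3 * 0\<^sup>2)\<^sup>2 \<le> (0::real)\<^sup>2 * (1 + 0\<^sup>2)"
    by (intro tendsto_le[OF trivial_limit_at])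
  then show "c1 = 0" by simp
qed

section \<open>The polar form of \<open>Q\<close> and the zeros of \<open>Q\<close> on rank-one
  matrices\<close>

definition BQ :: "real^3^3 \<Rightarrow> real^3^3 \<Rightarrow> real" where
  "BQ \<xi> \<eta> = (\<Sum>i\<in>UNIV. \<xi> $ i $ i * \<eta> $ i $ i - \<xi> $ i $ i * \<eta> $ (i + 1) $ (i + 1)
    - \<xi> $ (i + 1) $ (i + 1) * \<eta> $ i $ i + \<xi> $ i $ (i + 1) * \<eta> $ i $ (i + 1))"

lemma bilinear_BQ: "bilinear BQ"
  unfolding bilinear_def linear_iff BQ_def by (simp add: sum_3 algebra_simps)

lemma BQ_sym: "BQ x y = BQ y x"
  unfolding BQ_def by (simp add: sum_3 algebra_simps)

lemma Q_eq_BQ: "Q \<xi> = BQ \<xi> \<xi>"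
  unfolding BQ_def Q_def by (simp add: sum_3 power2_eq_square algebra_simps)

lemma quadratic_form_Q: "quadratic_form Q"
  unfolding quadratic_form_def using bilinear_BQ Q_eq_BQ by blast

lemma Q_tensor_nonneg: "0 \<le> Q (x \<otimes>\<^sub>t y)"
  using choi_lam_nonneg[of "x $ 1" "y $ 1" "x $ 2" "y $ 2" "x $ 3" "y $ 3"]
  unfolding Q_def by (simp add: algebra_simps)

lemma quasiconvex_form_Q: "quasiconvex_form Q"
  by (simp add: quasiconvex_form_def quadratic_form_Q Q_tensor_nonneg)

text \<open>Together with \<open>1\<close>, and up to an overall sign, these are all the sign
  vectors.\<close>

definition flip :: "3 \<Rightarrow> real^3"
  where "flip m = (\<chi> i. if i = m then - 1 else 1)"

lemma Q_ones: "Q (1 \<otimes>\<^sub>t 1) = 0"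
  by (simp add: Q_def)

lemma Q_flip: "Q (flip m \<otimes>\<^sub>t flip m) = 0"
  using exhaust_3[of m] by (auto simp: Q_def flip_def)

lemma Q_curve: "Q ((e i + t *\<^sub>R e (i + 2)) \<otimes>\<^sub>t (t *\<^sub>R e i + e (i + 2))) = t ^ 4"
  using exhaust_3[of i] by (auto simp: Q_def axis_def power2_eq_square eval_nat_numeral algebra_simps)

text \<open>Next to the factor \<open>t ^ 4\<close> of \<open>Q_curve\<close>, the other
  Cauchy-Schwarz factor only has to stay bounded near \<open>t = 0\<close>.\<close>

lemma Q_curve_left: "Q ((e i + t *\<^sub>R e (i + 2)) \<otimes>\<^sub>t e l) \<le> 1 + t\<^sup>2"
  using exhaust_3[of i] exhaust_3[of l] by (auto simp: Q_def axis_def)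

lemma Q_curve_right: "Q (e k \<otimes>\<^sub>t (t *\<^sub>R e i + e (i + 2))) \<le> 1 + t\<^sup>2"
  using exhaust_3[of i] exhaust_3[of k] by (auto simp: Q_def axis_def)

section \<open>Forms lying between \<open>0\<close> and \<open>Q\<close> on rank-one
  matrices\<close>

locale dominated_form =
  fixes B :: "real^3^3 \<Rightarrow> real^3^3 \<Rightarrow> real"
  assumes bilin: "bilinear B"
    and sym: "B \<xi> \<eta> = B \<eta> \<xi>"
    and nonneg: "0 \<le> B (x \<otimes>\<^sub>t y) (x \<otimes>\<^sub>t y)"
    and le_Q: "B (x \<otimes>\<^sub>t y) (x \<otimes>\<^sub>t y) \<le> Q (x \<otimes>\<^sub>t y)"
begin

lemmas lin = bilinear_ladd[OF bilin] bilinear_radd[OF bilin] bilinear_lmul[OF bilin]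
  bilinear_rmul[OF bilin]

text \<open>Matrices with a common first factor \<open>x\<close> form a linear space of rank at most
  one, so Cauchy-Schwarz is available for \<open>B\<close> there.\<close>

lemma bound_right: "(B (x \<otimes>\<^sub>t y) (x \<otimes>\<^sub>t z))\<^sup>2 \<le> Q (x \<otimes>\<^sub>t y) * Q (x \<otimes>\<^sub>t z)"
proof -
  have "(B (x \<otimes>\<^sub>t y) (x \<otimes>\<^sub>t z))\<^sup>2 \<le> B (x \<otimes>\<^sub>t y) (x \<otimes>\<^sub>t y) * B (x \<otimes>\<^sub>t z) (x \<otimes>\<^sub>t z)"
  proof (rule bilinear_Cauchy_Schwarz[OF bilin sym])
    show "0 \<le> B (x \<otimes>\<^sub>t y + s *\<^sub>R (x \<otimes>\<^sub>t z)) (x \<otimes>\<^sub>t y + s *\<^sub>R (x \<otimes>\<^sub>t z))" for s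
      using nonneg[of x "y + s *\<^sub>R z"] by (simp only: tensor_add_right tensor_scaleR_right)
  qed (rule nonneg)
  also have "\<dots> \<le> Q (x \<otimes>\<^sub>t y) * Q (x \<otimes>\<^sub>t z)"
    by (intro mult_mono le_Q nonneg Q_tensor_nonneg)
  finally show ?thesis .
qed

lemma bound_left: "(B (x \<otimes>\<^sub>t y) (w \<otimes>\<^sub>t y))\<^sup>2 \<le> Q (x \<otimes>\<^sub>t y) * Q (w \<otimes>\<^sub>t y)"
proof -
  have "(B (x \<otimes>\<^sub>t y) (w \<otimes>\<^sub>t y))\<^sup>2 \<le> B (x \<otimes>\<^sub>t y) (x \<otimes>\<^sub>t y) * B (w \<otimes>\<^sub>t y) (w \<otimes>\<^sub>t y)"
  proof (rule bilinear_Cauchy_Schwarz[OF bilin sym])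
    show "0 \<le> B (x \<otimes>\<^sub>t y + s *\<^sub>R (w \<otimes>\<^sub>t y)) (x \<otimes>\<^sub>t y + s *\<^sub>R (w \<otimes>\<^sub>t y))" for s
      using nonneg[of "x + s *\<^sub>R w" y] by (simp only: tensor_add_left tensor_scaleR_left)
  qed (rule nonneg)
  also have "\<dots> \<le> Q (x \<otimes>\<^sub>t y) * Q (w \<otimes>\<^sub>t y)"
    by (intro mult_mono le_Q nonneg Q_tensor_nonneg)
  finally show ?thesis .
qed

text \<open>The left-hand sides are the coefficients of \<open>1\<close> and \<open>t\<close> in
  \<open>B (?x \<otimes>\<^sub>t ?y) (?x \<otimes>\<^sub>t e l)\<close> along the curve of
  \<open>Q_curve\<close>, where this value is \<open>O(t\<^sup>2)\<close>.\<close>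

lemma curve_right:
  "B (E i (i + 2)) (E i l) = 0"
  "B (E i i) (E i l) + B (E (i + 2) (i + 2)) (E i l) + B (E i (i + 2)) (E (i + 2) l) = 0"
proof -
  define c0 where "c0 = B (E i (i + 2)) (E i l)"
  define c1 where "c1 = B (E i i) (E i l) + B (E (i + 2) (i + 2)) (E i l) + B (E i (i + 2)) (E (i + 2) l)"
  define c2 where "c2 = B (E i i) (E (i + 2) l) + B (E (i + 2) (i + 2)) (E (i + 2) l) + B (E (i + 2) i) (E i l)"
  define c3 where "c3 = B (E (i + 2) i) (E (i + 2) l)"
  have "(c0 + c1 * t + c2 * t\<^sup>2 + c3 * t ^ 3)\<^sup>2 \<le> t ^ 4 * (1 + t\<^sup>2)" for t
  proof -
    let ?x = "e i + t *\<^sub>R e (i + 2)" and ?y = "t *\<^sub>R e i + e (i + 2)"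
    have "B (?x \<otimes>\<^sub>t ?y) (?x \<otimes>\<^sub>t e l) = c0 + c1 * t + c2 * t\<^sup>2 + c3 * t ^ 3"
      unfolding c0_def c1_def c2_def c3_def tensor_add_left tensor_add_right tensor_scaleR_left tensor_scaleR_right lin
      by (simp add: power2_eq_square eval_nat_numeral algebra_simps)
    then have "(c0 + c1 * t + c2 * t\<^sup>2 + c3 * t ^ 3)\<^sup>2 \<le> t ^ 4 * Q (?x \<otimes>\<^sub>t e l)"
      using bound_right[of ?x ?y "e l"] by (simp only: Q_curve)
    also have "\<dots> \<le> t ^ 4 * (1 + t\<^sup>2)"
      by (intro mult_left_mono Q_curve_left) simp
    finally show ?thesis .
  qed
  from linear_coeff_zero[OF this] show "B (E i (i + 2)) (E i l) = 0"
      "B (E i i) (E i l) + B (E (i + 2) (i + 2)) (E i l) + B (E i (i + 2)) (E (i + 2) l) = 0"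
    by (simp_all add: c0_def c1_def)
qed

lemma curve_left:
  "B (E i (i + 2)) (E k (i + 2)) = 0"
  "B (E i i) (E k (i + 2)) + B (E (i + 2) (i + 2)) (E k (i + 2)) + B (E i (i + 2)) (E k i) = 0"
proof -
  define c0 where "c0 = B (E i (i + 2)) (E k (i + 2))"
  define c1 where "c1 = B (E i i) (E k (i + 2)) + B (E (i + 2) (i + 2)) (E k (i + 2)) + B (E i (i + 2)) (E k i)"
  define c2 where "c2 = B (E i i) (E k i) + B (E (i + 2) (i + 2)) (E k i) + B (E (i + 2) i) (E k (i + 2))"
  define c3 where "c3 = B (E (i + 2) i) (E k i)"
  have "(c0 + c1 * t + c2 * t\<^sup>2 + c3 * t ^ 3)\<^sup>2 \<le> t ^ 4 * (1 + t\<^sup>2)" for t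
  proof -
    let ?x = "e i + t *\<^sub>R e (i + 2)" and ?y = "t *\<^sub>R e i + e (i + 2)"
    have "B (?x \<otimes>\<^sub>t ?y) (e k \<otimes>\<^sub>t ?y) = c0 + c1 * t + c2 * t\<^sup>2 + c3 * t ^ 3"
      unfolding c0_def c1_def c2_def c3_def tensor_add_left tensor_add_right tensor_scaleR_left tensor_scaleR_right lin
      by (simp add: power2_eq_square eval_nat_numeral algebra_simps)
    then have "(c0 + c1 * t + c2 * t\<^sup>2 + c3 * t ^ 3)\<^sup>2 \<le> t ^ 4 * Q (e k \<otimes>\<^sub>t ?y)"
      using bound_left[of ?x ?y "e k"] by (simp only: Q_curve)
    also have "\<dots> \<le> t ^ 4 * (1 + t\<^sup>2)"
      by (intro mult_left_mono Q_curve_right) simp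
    finally show ?thesis .
  qed
  from linear_coeff_zero[OF this] show "B (E i (i + 2)) (E k (i + 2)) = 0"
      "B (E i i) (E k (i + 2)) + B (E (i + 2) (i + 2)) (E k (i + 2)) + B (E i (i + 2)) (E k i) = 0"
    by (simp_all add: c0_def c1_def)
qed

lemma zero_right: "B (x \<otimes>\<^sub>t y) (x \<otimes>\<^sub>t z) = 0" if "Q (x \<otimes>\<^sub>t y) = 0"
  using bound_right[of x y z] that by simp

text \<open>This polarises the claim that \<open>B\<close> is a multiple of \<open>Q\<close> on
  rank-one matrices; the multiple is read off at \<open>E 1 1\<close>, where \<open>Q\<close> is
  \<open>1\<close>. The proof solves a linear system in the coefficients of
  \<open>B\<close>.\<close>

lemma coeff_eq:
  "B (E i j) (E k l) + B (E i l) (E k j) = B (E 1 1) (E 1 1) * (BQ (E i j) (E k l) + BQ (E i l) (E k j))"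
proof -
  define b where "b i j k l = B (E i j) (E k l)" for i j k l
  have sy: "b i j k l = b k l i j" for i j k l by (simp add: b_def sym)
  note sys = sy[of 2 _ 1] sy[of 3 _ 1] sy[of 3 _ 2] sy[of i 2 i 1 for i] sy[of i 3 i 1 for i] sy[of i 3 i 2 for i]
  have cr1: "\<forall>i l. b i (i + 2) i l = 0" and cl1: "\<forall>i k. b i (i + 2) k (i + 2) = 0"
    using curve_right(1) curve_left(1) by (simp_all add: b_def)
  have cr2: "\<forall>i l. b i i i l + b (i + 2) (i + 2) i l + b i (i + 2) (i + 2) l = 0"
    using curve_right(2) by (simp add: b_def)
  have cl2: "\<forall>i k. b i i k (i + 2) + b (i + 2) (i + 2) k (i + 2) + b i (i + 2) k i = 0"
    using curve_left(2) by (simp add: b_def)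
  note expand = bilinear_expand[OF bilin, folded b_def]
  have ones: "B (1 \<otimes>\<^sub>t 1) (1 \<otimes>\<^sub>t e l) = 0" for l
    by (rule zero_right[OF Q_ones])
  have signs: "\<forall>m. B (flip m \<otimes>\<^sub>t flip m) (flip m \<otimes>\<^sub>t e l) = 0" for l
    using zero_right[OF Q_flip] by blast
  note curve = cr1[simplified forall_3, simplified, simplified sys]
    cl1[simplified forall_3, simplified, simplified sys]
    cr2[simplified forall_3, simplified, simplified sys]
    cl2[simplified forall_3, simplified, simplified sys]
  \<comment> \<open>These use the degenerate zeros alone. For instance, \<open>cr2\<close> at
    \<open>i = 1, l = 1\<close> and \<open>cl2\<close> at \<open>i = 1, k = 3\<close> share two of
    their three terms, whence \<open>b 3 3 3 3 = b 1 1 1 1\<close>.\<close>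
  have solved: "b 1 3 3 3 = 0" "b 2 1 2 2 = 0" "b 3 2 3 3 = 0"
    "b 2 2 2 2 = b 1 1 1 1" "b 3 3 3 3 = b 1 1 1 1"
    "b 1 2 2 1 = - b 1 1 1 1 - b 1 1 2 2" "b 1 3 3 1 = - b 1 1 1 1 - b 1 1 3 3"
    "b 2 3 3 2 = - b 1 1 1 1 - b 2 2 3 3"
    "b 1 2 2 2 = b 1 1 1 2" "b 2 3 3 3 = b 2 2 2 3" "b 1 1 3 1 = b 3 1 3 3"
    "b 1 3 3 2 = - b 1 1 1 2 - b 1 2 3 3" "b 1 3 2 1 = - b 2 2 2 3 - b 1 1 2 3"
    "b 2 1 3 2 = - b 3 1 3 3 - b 2 2 3 1"
    using curve by linarith+
  \<comment> \<open>For each \<open>l\<close> the four sign vectors give four linear equations in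
    the coefficients that \<open>curve\<close> leaves open.\<close>
  note sgn = ones[unfolded expand sum_3] signs[unfolded expand sum_3 forall_3 flip_def]
  note sgn1 = sgn[where l = 1, unfolded axis_def, simplified, simplified sys curve(1,2) solved]
    and sgn2 = sgn[where l = 2, unfolded axis_def, simplified, simplified sys curve(1,2) solved]
    and sgn3 = sgn[where l = 3, unfolded axis_def, simplified, simplified sys curve(1,2) solved]
  have "b 3 1 3 1 = b 1 1 1 1" "b 3 1 3 3 = 0"
    using sgn1 by linarith+
  moreover have "b 1 2 1 2 = b 1 1 1 1" "b 1 1 1 2 = 0"
    using sgn2 by linarith+
  moreover have "b 2 3 2 3 = b 1 1 1 1" "b 2 2 2 3 = 0"
    using sgn3 by linarith+
  moreover from calculation sgn1 have "b 2 1 3 3 = - b 2 3 3 1"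
    by linarith
  moreover from calculation sgn2 have "b 1 2 3 1 = - b 1 1 3 2"
    by linarith
  moreover from calculation sgn3 have "b 1 3 2 2 = - b 1 2 2 3"
    by linarith
  ultimately have "\<forall>i j k l. b i j k l + b i l k j = b 1 1 1 1 * (BQ (E i j) (E k l) + BQ (E i l) (E k j))"
    using curve(1,2) by (simp add: forall_3 sum_3 axis_def sys BQ_def solved)
  then show ?thesis by (simp add: b_def)
qed

lemma null_lagrangian_diff: "null_lagrangian (\<lambda>\<xi>. B \<xi> \<xi> - B (E 1 1) (E 1 1) * Q \<xi>)"
  unfolding Q_eq_BQ
proof (rule null_lagrangianI[of "\<lambda>\<xi> \<eta>. B \<xi> \<eta> - B (E 1 1) (E 1 1) * BQ \<xi> \<eta>"])
  show "bilinear (\<lambda>\<xi> \<eta>. B \<xi> \<eta> - B (E 1 1) (E 1 1) * BQ \<xi> \<eta>)"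
    using bilin bilinear_BQ unfolding bilinear_def linear_iff by (simp add: algebra_simps)
  show "B x y - B (E 1 1) (E 1 1) * BQ x y = B y x - B (E 1 1) (E 1 1) * BQ y x" for x y
    by (simp only: sym[of x y] BQ_sym[of x y])
qed (use coeff_eq in \<open>simp add: algebra_simps\<close>)

end

section \<open>Extremality in senses 2 and 1\<close>

lemma extremal_sense2_Q: "extremal_sense2 Q"
  unfolding extremal_sense2_def
proof (intro conjI quasiconvex_form_Q allI impI)
  fix g assume g: "quasiconvex_form g \<and> quasiconvex_form (\<lambda>\<xi>. Q \<xi> - g \<xi>)"
  then obtain B where B: "bilinear B" "\<And>x y. B x y = B y x" "\<And>\<xi>. g \<xi> = B \<xi> \<xi>"
    unfolding quasiconvex_form_def by (metis quadratic_formE)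
  interpret dominated_form B
    using B(1,2) g unfolding quasiconvex_form_def B(3) by unfold_locales auto
  show "\<exists>c. null_lagrangian (\<lambda>\<xi>. g \<xi> - c * Q \<xi>)"
    unfolding B(3) using null_lagrangian_diff by blast
qed

lemma extremal_sense1_Q: "extremal_sense1 Q"
  unfolding extremal_sense1_def
proof (intro conjI quasiconvex_form_Q notI)
  assume "\<exists>g. rank_one_form g \<and> quasiconvex_form (\<lambda>\<xi>. Q \<xi> - g \<xi>)"
  then obtain g b where qc: "quasiconvex_form (\<lambda>\<xi>. Q \<xi> - g \<xi>)" and "b \<noteq> 0"
    and g: "\<And>\<xi>. g \<xi> = (\<Sum>i\<in>UNIV. \<Sum>j\<in>UNIV. b $ i $ j * \<xi> $ i $ j)\<^sup>2"
    unfolding rank_one_form_def by blast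
  define l :: "real^3^3 \<Rightarrow> real" where "l \<xi> = (\<Sum>i\<in>UNIV. \<Sum>j\<in>UNIV. b $ i $ j * \<xi> $ i $ j)" for \<xi>
  define B where "B \<xi> \<eta> = l \<xi> * l \<eta>" for \<xi> \<eta>
  have "linear l"
    by (simp add: linear_iff l_def sum_3 algebra_simps)
  then have "bilinear B"
    by (simp add: bilinear_def linear_iff B_def algebra_simps)
  moreover have "g \<xi> = B \<xi> \<xi>" for \<xi>
    by (simp add: g B_def l_def power2_eq_square)
  ultimately interpret dominated_form B
    using qc unfolding quasiconvex_form_def by unfold_locales (auto simp: B_def)
  have l_E: "l (E i j) = b $ i $ j" for i j
    using exhaust_3[of i] exhaust_3[of j] by (auto simp: l_def sum_3 axis_def)
  \<comment> \<open>This is the multiple from \<open>coeff_eq\<close>, here visibly a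
    square.\<close>
  define a where "a = b $ 1 $ 1 * b $ 1 $ 1"
  have *: "b $ i $ j * b $ k $ m + b $ i $ m * b $ k $ j = a * (BQ (E i j) (E k m) + BQ (E i m) (E k j))"
    for i j k m
    using coeff_eq[of i j k m] by (simp add: B_def l_E a_def)
  note * = this[unfolded BQ_def sum_3 axis_def, simplified]
  have off: "b $ 1 $ 3 = 0" "b $ 2 $ 1 = 0" "b $ 3 $ 2 = 0"
    using *[of 1 3 1 3] *[of 2 1 2 1] *[of 3 2 3 2] by simp_all
  have p: "b $ 1 $ 1 * b $ 2 $ 2 = - a" "b $ 2 $ 2 * b $ 3 $ 3 = - a" "b $ 3 $ 3 * b $ 1 $ 1 = - a"
    using *[of 1 1 2 2] *[of 2 2 3 3] *[of 3 3 1 1] off by simp_all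
  have "(b $ 1 $ 1 * b $ 2 $ 2 * b $ 3 $ 3)\<^sup>2 = (b $ 1 $ 1 * b $ 2 $ 2) * (b $ 2 $ 2 * b $ 3 $ 3) * (b $ 3 $ 3 * b $ 1 $ 1)"
    by (simp add: power2_eq_square)
  also have "\<dots> = - (a ^ 3)" unfolding p by (simp add: eval_nat_numeral)
  finally have "a ^ 3 \<le> 0" by (metis neg_0_le_iff_le zero_le_power2)
  then have "a \<le> 0" by (simp add: power_le_zero_eq)
  moreover have "0 \<le> a" by (simp add: a_def)
  ultimately have "a = 0" by simp
  then have "b $ i $ i = 0" "b $ 1 $ 2 = 0" "b $ 2 $ 3 = 0" "b $ 3 $ 1 = 0" for i
    using *[of i i i i] *[of 1 2 1 2] *[of 2 3 2 3] *[of 3 1 3 1] by simp_all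
  then have "b = 0" using off by (simp add: vec_eq_iff forall_3)
  with \<open>b \<noteq> 0\<close> show False by simp
qed

section \<open>Failure of polyconvexity\<close>

lemma null_lagrangian_tensor: "null_lagrangian h \<Longrightarrow> h (x \<otimes>\<^sub>t y) = 0"
  by (auto simp: null_lagrangian_def minor2_def)

text \<open>The midpoint of \<open>x\<close> and \<open>- x\<close> is \<open>0\<close>, where the
  form vanishes.\<close>

lemma convex_quadratic_nonneg:
  assumes "bilinear B" "convex_on UNIV (\<lambda>x. B x x :: real)"
  shows "0 \<le> B x x"
proof -
  have "B ((1/2) *\<^sub>R x + (1/2) *\<^sub>R (- x)) ((1/2) *\<^sub>R x + (1/2) *\<^sub>R (- x)) \<le> (1/2) * B x x + (1/2) * B (- x) (- x)"
    using convex_onD[OF assms(2), of "1/2" x "- x"] by simp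
  then show ?thesis
    by (simp add: bilinear_lneg[OF assms(1)] bilinear_rneg[OF assms(1)] bilinear_lzero[OF assms(1)])
qed

lemma not_polyconvex_Q: "\<not> polyconvex_form Q"
proof
  assume "polyconvex_form Q"
  then obtain g h where g: "quadratic_form g" "convex_on UNIV g" and h: "null_lagrangian h"
    and Q: "\<And>\<xi>. Q \<xi> = g \<xi> + h \<xi>"
    unfolding polyconvex_form_def by blast
  obtain B where B: "bilinear B" "\<And>x y. B x y = B y x" "\<And>\<xi>. g \<xi> = B \<xi> \<xi>"
    using quadratic_formE[OF g(1)] by blast
  have nonneg: "0 \<le> B \<xi> \<xi>" for \<xi>
    using convex_quadratic_nonneg[OF B(1)] g(2) by (simp add: B(3)[symmetric])
  have tensor: "B (x \<otimes>\<^sub>t y) (x \<otimes>\<^sub>t y) = Q (x \<otimes>\<^sub>t y)" for x y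
    using Q null_lagrangian_tensor[OF h] by (simp add: B(3))
  have ker: "B (x \<otimes>\<^sub>t y) \<eta> = 0" if "Q (x \<otimes>\<^sub>t y) = 0" for x y \<eta>
    using bilinear_Cauchy_Schwarz[OF B(1,2) nonneg nonneg, of "x \<otimes>\<^sub>t y" \<eta>] that by (simp add: tensor)
  \<comment> \<open>Each \<open>s \<otimes>\<^sub>t s\<close> is weighted by the sign of its entry
    \<open>(1, 2)\<close>, which cancels everything except the positions \<open>(1, 2)\<close> and
    \<open>(2, 1)\<close>. All terms other than \<open>E 1 2\<close> are zeros of
    \<open>Q\<close>.\<close>
  have "1 \<otimes>\<^sub>t 1 + flip 3 \<otimes>\<^sub>t flip 3
    = flip 1 \<otimes>\<^sub>t flip 1 + flip 2 \<otimes>\<^sub>t flip 2 + 4 *\<^sub>R E 2 1 + 4 *\<^sub>R E 1 2"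
    by (simp add: vec_eq_iff forall_3 flip_def axis_def)
  then have "B (1 \<otimes>\<^sub>t 1 + flip 3 \<otimes>\<^sub>t flip 3) (E 1 2)
    = B (flip 1 \<otimes>\<^sub>t flip 1 + flip 2 \<otimes>\<^sub>t flip 2 + 4 *\<^sub>R E 2 1 + 4 *\<^sub>R E 1 2) (E 1 2)"
    by (rule arg_cong)
  moreover have "Q (E 2 1) = 0" by (simp add: Q_def axis_def)
  ultimately have "B (E 1 2) (E 1 2) = 0"
    by (simp add: bilinear_ladd[OF B(1)] bilinear_lmul[OF B(1)] ker Q_ones Q_flip)
  then show False by (simp add: tensor Q_def axis_def)
qed

theorem theorem1p5:
  shows "quasiconvex_form Q \<and> \<not> polyconvex_form Q \<and>
    extremal_sense1 Q \<and> extremal_sense2 Q \<and> extremal_sense3 Q"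
  by (simp add: quasiconvex_form_Q not_polyconvex_Q extremal_sense1_Q extremal_sense2_Q
      extremal_sense3_def)

end
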